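(* Let $n$ be a positive integer. Every submodule of $\mathbb{C}[x_1,\ldots ,x_n]$ is the sum of finitely many indecomposable submodules.
   Context: A submodule of $\mathbb{C}[x_1,\ldots,x_n]$ is a translation invariant linear subspace of $\mathbb{C}[x_1,\ldots,x_n]$; equivalently, a linear subspace closed under all partial derivatives $\partial/\partial x_i$. The sum of sets of polynomials is $A+B=\{f+g\colon f\in A, g\in B\}$. A submodule $M$ is decomposable if $M=A_1+\cdots+A_k$ for some $k\ge 1$ and some proper submodules $A_1,\ldots,A_k$ of $M$ (submodules of $\mathbb{C}[x_1,\ldots,x_n]$ contained in $M$ and different from $M$). Otherwise $M$ is indecomposable. *)

theory Defs
  imports Complex_Main "HOL-Library.Poly_Mapping" "HOL-Library.Set_Algebras"
begin

text \<open>
  The ring \<open>\<complex>[x\<^sub>1, \<dots>, x\<^sub>n]\<close> is the type of finitely supported maps from exponent vectors to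
  coefficients, with the convolution product. The variables are indexed by a finite type \<open>'n\<close>,
  so that \<open>n = CARD('n)\<close> is an arbitrary positive integer.
\<close>

type_synonym 'n cpoly = "('n \<Rightarrow>\<^sub>0 nat) \<Rightarrow>\<^sub>0 complex"

definition const :: "complex \<Rightarrow> 'n cpoly" where
  "const c = Poly_Mapping.single 0 c"

definition var :: "'n \<Rightarrow> 'n cpoly" where
  "var i = Poly_Mapping.single (Poly_Mapping.single i 1) 1"

definition scale :: "complex \<Rightarrow> 'n cpoly \<Rightarrow> 'n cpoly" where
  "scale c p = const c * p"

global_interpretation cpoly: vector_space scale
  by unfold_locales
    (simp_all add: scale_def const_def distrib_left distrib_right single_add
      mult_single flip: mult.assoc)

text \<open>The polynomial \<open>f(x + a)\<close>, obtained by substituting \<open>x\<^sub>i + a\<^sub>i\<close> for each \<open>x\<^sub>i\<close>:\<close>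

definition translate :: "('n::finite \<Rightarrow> complex) \<Rightarrow> 'n cpoly \<Rightarrow> 'n cpoly" where
  "translate a f =
     (\<Sum>m\<in>Poly_Mapping.keys f.
        scale (Poly_Mapping.lookup f m)
          (\<Prod>i\<in>UNIV. (var i + const (a i)) ^ Poly_Mapping.lookup m i))"

definition submodule :: "('n::finite) cpoly set \<Rightarrow> bool" where
  "submodule M \<longleftrightarrow> cpoly.subspace M \<and> (\<forall>a. \<forall>f\<in>M. translate a f \<in> M)"

text \<open>
  Sums of sets are the elementwise sums \<open>A + B = {f + g | f \<in> A, g \<in> B}\<close> of
  \<^theory>\<open>HOL-Library.Set_Algebras\<close>.
\<close>

definition decomposable :: "('n::finite) cpoly set \<Rightarrow> bool" where
  "decomposable M \<longleftrightarrow>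
     (\<exists>k\<ge>1. \<exists>A :: nat \<Rightarrow> 'n cpoly set.
        (\<forall>i<k. submodule (A i) \<and> A i \<subset> M) \<and> M = (\<Sum>i<k. A i))"

definition indecomposable :: "('n::finite) cpoly set \<Rightarrow> bool" where
  "indecomposable M \<longleftrightarrow> submodule M \<and> \<not> decomposable M"

end

theory Submission
  imports Defs "HOL-Computational_Algebra.Primes"
begin

text \<open>
  The submodules satisfy the descending chain condition, and the statement follows by well-founded
  induction along strict inclusion: a submodule is either indecomposable or a sum of finitely many
  strictly smaller submodules, each of which is a finite sum of indecomposable ones.

  The chain condition is a Groebner-style argument. Fix a well-ordering of the monomials that is
  compatible with multiplication. If \<open>f\<close> has leading exponent \<open>m\<close> and \<open>m\<^sub>i > 0\<close>, then the difference
  \<open>f(x + e\<^sub>i) - f(x)\<close>, with \<open>e\<^sub>i\<close> the \<open>i\<close>-th unit vector, has leading exponent \<open>m - e\<^sub>i\<close>, because in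
  characteristic zero the factor \<open>m\<^sub>i\<close> does not vanish. So the leading exponents of a submodule form a
  set that is closed under passing to smaller vectors of \<open>\<nat>\<^sup>n\<close> (\<open>lead_exps_down_closed\<close>). Reducing by
  leading terms shows that nested submodules with equal sets of leading exponents coincide
  (\<open>lead_exps_determine\<close>). Finally, Dickson's lemma (\<open>dickson\<close>) excludes an infinite strictly
  descending sequence of such closed sets: if \<open>u\<^sub>k\<close> is lost at the \<open>k\<close>-th step, then no later \<open>u\<^sub>l\<close>
  can lie above \<open>u\<^sub>k\<close>, since closedness would bring \<open>u\<^sub>k\<close> back.
\<close>

section \<open>Dickson's lemma\<close>

lemma nat_seq_nondecreasing_subseq:
  fixes s :: "nat \<Rightarrow> nat"
  obtains r where "strict_mono r" "incseq (\<lambda>k. s (r k))"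
proof -
  obtain r :: "nat \<Rightarrow> nat" where r: "strict_mono r" "monoseq (\<lambda>k. s (r k))"
    using seq_monosub[of s] by auto
  show ?thesis
  proof (cases "incseq (\<lambda>k. s (r k))")
    case True
    with r that show ?thesis by blast
  next
    case False
    with r have dec: "decseq (\<lambda>k. s (r k))"
      by (auto simp: monoseq_iff)
    \<comment> \<open>A nonincreasing sequence of naturals is constant from the place of its minimum on.\<close>
    define v where "v = (LEAST v. \<exists>k. v = s (r k))"
    have "\<exists>k. v = s (r k)"
      unfolding v_def by (rule LeastI_ex) blast
    then obtain N where N: "v = s (r N)" by blast
    have "v \<le> s (r k)" for k
      unfolding v_def by (rule Least_le) blast
    with N dec have "s (r (N + k)) = v" for k
      by (metis decseqD le_add1 le_antisym)
    then have "incseq (\<lambda>k. s (r (N + k)))"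
      by (simp add: incseq_def)
    moreover have "strict_mono (\<lambda>k. r (N + k))"
      using r(1) by (simp add: strict_mono_def)
    ultimately show ?thesis by (rule that[rotated])
  qed
qed

lemma dickson:
  fixes u :: "nat \<Rightarrow> ('n::finite \<Rightarrow>\<^sub>0 nat)"
  obtains i j where "i < j" "\<And>k. Poly_Mapping.lookup (u i) k \<le> Poly_Mapping.lookup (u j) k"
proof -
  have "\<exists>r. strict_mono r \<and> (\<forall>k\<in>S. incseq (\<lambda>j. Poly_Mapping.lookup (u (r j)) k))"
    if "finite S" for S :: "'n set"
    using that
  proof induction
    case empty
    show ?case using strict_mono_id by auto
  next
    case (insert x S)
    then obtain r where r: "strict_mono r"
      "\<forall>k\<in>S. incseq (\<lambda>j. Poly_Mapping.lookup (u (r j)) k)" by blast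
    obtain q where q: "strict_mono q" "incseq (\<lambda>j. Poly_Mapping.lookup (u (r (q j))) x)"
      by (rule nat_seq_nondecreasing_subseq[of "\<lambda>j. Poly_Mapping.lookup (u (r j)) x"])
    have "strict_mono (\<lambda>j. r (q j))"
      using r(1) q(1) by (simp add: strict_mono_def)
    moreover have "incseq (\<lambda>j. Poly_Mapping.lookup (u (r (q j))) k)" if "k \<in> S" for k
      using r(2) that q(1) by (auto simp: incseq_def strict_mono_less_eq)
    ultimately show ?case using q(2) by (intro exI[of _ "\<lambda>j. r (q j)"]) auto
  qed
  from this[of UNIV] obtain r where
    r: "strict_mono r" "\<And>k. incseq (\<lambda>j. Poly_Mapping.lookup (u (r j)) k)" by auto
  show ?thesis
  proof (rule that)
    show "r 0 < r 1" using r(1) by (simp add: strict_mono_def)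
    show "Poly_Mapping.lookup (u (r 0)) k \<le> Poly_Mapping.lookup (u (r 1)) k" for k
      using r(2)[of k] by (simp add: incseq_def)
  qed
qed

section \<open>A monomial order\<close>

text \<open>
  A well-ordering of the exponent vectors that is compatible with addition is encoded by an
  injective homomorphism into the multiplicative monoid of the naturals; comparing ranks then
  compares monomials, and well-foundedness comes for free.
\<close>

locale monomial_rank =
  fixes rank :: "('n::finite \<Rightarrow>\<^sub>0 nat) \<Rightarrow> nat"
  assumes inj_rank: "inj rank"
    and rank_add: "rank (a + b) = rank a * rank b"
begin

lemma rank_pos: "rank a > 0"
proof (rule ccontr)
  assume "\<not> rank a > 0"
  then have "rank (a + Poly_Mapping.single undefined 1) = rank a"
    by (simp add: rank_add)
  then have "a + Poly_Mapping.single undefined 1 = a"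
    using inj_rank by (simp add: inj_eq)
  then show False
    by (metis add_cancel_left_right lookup_single_eq lookup_zero zero_neq_one)
qed

lemma rank_le_add: "rank a \<le> rank (a + b)"
  using rank_pos[of b] by (simp add: rank_add)

definition leads :: "('n \<Rightarrow>\<^sub>0 nat) \<Rightarrow> 'n cpoly \<Rightarrow> bool" where
  "leads m f \<longleftrightarrow> m \<in> Poly_Mapping.keys f \<and> (\<forall>q\<in>Poly_Mapping.keys f. rank q \<le> rank m)"

definition lead_exps :: "'n cpoly set \<Rightarrow> ('n \<Rightarrow>\<^sub>0 nat) set" where
  "lead_exps M = {m. \<exists>f\<in>M. leads m f}"

lemma ex_leads:
  assumes "f \<noteq> 0"
  obtains m where "leads m f"
proof -
  have "\<exists>m. m \<in> Poly_Mapping.keys f \<and> (\<forall>q\<in>Poly_Mapping.keys f. rank q \<le> rank m)"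
    using Max_in[of "rank ` Poly_Mapping.keys f"] Max_ge[of "rank ` Poly_Mapping.keys f"] assms
    by fastforce
  then show ?thesis
    using that by (auto simp: leads_def)
qed

end

text \<open>
  Evaluating a monomial at pairwise distinct primes is injective by unique factorization.
\<close>

lemma ex_monomial_rank: "\<exists>rank :: ('n::finite \<Rightarrow>\<^sub>0 nat) \<Rightarrow> nat. monomial_rank rank"
proof -
  obtain e :: "'n \<Rightarrow> nat" where e: "inj e"
    using finite_imp_inj_to_nat_seg[of "UNIV :: 'n set"] by auto
  obtain g :: "nat \<Rightarrow> nat" where g: "inj g" "range g \<subseteq> {p. prime p}"
    using infinite_countable_subset[OF primes_infinite] by auto
  define p where "p i = g (e i)" for i :: 'n
  have p: "inj p" "\<And>i. prime (p i)"
    using e g by (auto simp: p_def inj_def image_subset_iff)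
  define rank where "rank m = (\<Prod>i\<in>UNIV. p i ^ Poly_Mapping.lookup m i)" for m :: "'n \<Rightarrow>\<^sub>0 nat"
  have mult: "multiplicity (p i) (rank m) = Poly_Mapping.lookup m i" for i m
  proof -
    have image: "rank m = (\<Prod>q\<in>range p. q ^ Poly_Mapping.lookup m (inv p q))"
      using p(1) by (simp add: rank_def prod.reindex)
    then show ?thesis
      using p by (subst image, subst multiplicity_prod_prime_powers) auto
  qed
  have "monomial_rank rank"
  proof
    show "inj rank"
      by (rule injI) (metis mult poly_mapping_eqI)
    show "rank (a + b) = rank a * rank b" for a b
      by (simp add: rank_def lookup_add power_add prod.distrib)
  qed
  then show ?thesis by blast
qed

section \<open>Differences of translates\<close>

definition unit_shift :: "'n::finite \<Rightarrow> 'n \<Rightarrow> complex" where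
  "unit_shift i = (\<lambda>k. if k = i then 1 else 0)"

lemma var_power: "var i ^ r = Poly_Mapping.single (Poly_Mapping.single i r) 1"
  by (induction r) (simp_all add: var_def mult_single single_add[symmetric] flip: single_one)

lemma prod_single:
  "finite S \<Longrightarrow> (\<Prod>k\<in>S. Poly_Mapping.single (h k) (1::complex)) = Poly_Mapping.single (\<Sum>k\<in>S. h k) 1"
  by (induction rule: finite_induct) (simp_all add: mult_single flip: single_one)

lemma sum_single_lookup:
  "(\<Sum>k\<in>UNIV. Poly_Mapping.single k (Poly_Mapping.lookup m k)) = (m :: 'n::finite \<Rightarrow>\<^sub>0 nat)"
  by (rule poly_mapping_eqI) (simp add: lookup_sum lookup_single when_def)

lemma lookup_scale: "Poly_Mapping.lookup (scale c f) q = c * Poly_Mapping.lookup f q"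
  by (simp add: scale_def const_def lookup_mult lookup_single when_mult)

lemma lookup_shifted_monomial:
  fixes m :: "'n::finite \<Rightarrow>\<^sub>0 nat"
  shows "Poly_Mapping.lookup
      (\<Prod>k\<in>UNIV. (var k + const (unit_shift i k)) ^ Poly_Mapping.lookup m k) q =
    (\<Sum>j\<le>Poly_Mapping.lookup m i.
       of_nat (Poly_Mapping.lookup m i choose j) when m = q + Poly_Mapping.single i j)"
proof -
  let ?r = "Poly_Mapping.lookup m i"
  define m' where "m' = (\<Sum>k\<in>UNIV - {i}. Poly_Mapping.single k (Poly_Mapping.lookup m k))"
  have m: "m = Poly_Mapping.single i ?r + m'"
    using sum.remove[of UNIV i "\<lambda>k. Poly_Mapping.single k (Poly_Mapping.lookup m k)"]
    by (simp add: sum_single_lookup m'_def)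
  have "(\<Prod>k\<in>UNIV. (var k + const (unit_shift i k)) ^ Poly_Mapping.lookup m k) =
      (var i + 1) ^ ?r * (\<Prod>k\<in>UNIV - {i}. var k ^ Poly_Mapping.lookup m k)"
    by (subst prod.remove[of UNIV i]) (auto simp: unit_shift_def const_def intro!: prod.cong)
  also have "(\<Prod>k\<in>UNIV - {i}. var k ^ Poly_Mapping.lookup m k) = Poly_Mapping.single m' 1"
    by (simp add: var_power prod_single m'_def)
  also have "(var i + 1) ^ ?r = (1 + var i) ^ ?r"
    by (simp add: add.commute)
  also have "\<dots> = (\<Sum>j\<le>?r. of_nat (?r choose j) * Poly_Mapping.single (Poly_Mapping.single i (?r - j)) 1)"
    by (simp add: binomial_ring var_power)
  also have "\<dots> * Poly_Mapping.single m' 1 =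
      (\<Sum>j\<le>?r. Poly_Mapping.single (Poly_Mapping.single i (?r - j) + m') (of_nat (?r choose j)))"
    by (simp add: sum_distrib_right mult_single mult.assoc flip: single_of_nat)
  also have "Poly_Mapping.lookup \<dots> q =
      (\<Sum>j\<le>?r. of_nat (?r choose j) when Poly_Mapping.single i (?r - j) + m' = q)"
    by (simp add: lookup_sum lookup_single)
  also have "\<dots> = (\<Sum>j\<le>?r. of_nat (?r choose j) when m = q + Poly_Mapping.single i j)"
  proof (rule sum.cong)
    fix j assume "j \<in> {..?r}"
    then have "m = Poly_Mapping.single i (?r - j) + m' + Poly_Mapping.single i j"
      by (subst m) (simp add: ac_simps flip: single_add)
    then have "Poly_Mapping.single i (?r - j) + m' = q \<longleftrightarrow> m = q + Poly_Mapping.single i j"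
      by (metis add_right_cancel)
    then show "((of_nat (?r choose j) :: complex) when Poly_Mapping.single i (?r - j) + m' = q) =
        (of_nat (?r choose j) when m = q + Poly_Mapping.single i j)" by simp
  qed simp
  finally show ?thesis .
qed

text \<open>
  The coefficient form of the Taylor expansion \<open>f(x + e\<^sub>i) - f(x) = \<Sum>\<^sub>j\<^sub>\<ge>\<^sub>1 \<partial>\<^sub>i\<^sup>j f / j!\<close>.
\<close>

lemma lookup_unit_difference:
  "Poly_Mapping.lookup (translate (unit_shift i) f - f) q =
    (\<Sum>m\<in>Poly_Mapping.keys f. Poly_Mapping.lookup f m *
      (\<Sum>j=1..Poly_Mapping.lookup m i.
         of_nat (Poly_Mapping.lookup m i choose j) when m = q + Poly_Mapping.single i j))"
proof -
  have split0: "(\<Sum>j\<le>r. h j) = h 0 + (\<Sum>j=1..r. h j)" for r and h :: "nat \<Rightarrow> complex"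
    by (simp add: sum.atMost_shift sum.shift_bounds_cl_Suc_ivl atLeast0AtMost sum.atLeast1_atMost_eq
        lessThan_Suc_atMost)
  have "(\<Sum>m\<in>Poly_Mapping.keys f. Poly_Mapping.lookup f m * (1 when m = q)) =
      Poly_Mapping.lookup f q"
    by (cases "q \<in> Poly_Mapping.keys f") (auto simp: when_def in_keys_iff if_distrib cong: if_cong)
  then show ?thesis
    by (simp add: translate_def lookup_minus lookup_sum lookup_scale lookup_shifted_monomial
        split0 distrib_left sum.distrib)
qed

section \<open>Leading exponents of submodules\<close>

context monomial_rank
begin

text \<open>
  Every exponent of the difference arises from an exponent of \<open>f\<close> by lowering the \<open>i\<close>-th entry at
  least once, so its rank is at most that of the lowered leading exponent. That one itself arises
  only from the leading term, with the nonzero factor \<open>m\<^sub>i\<close>.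
\<close>

lemma leads_unit_difference:
  assumes lead: "leads (q + Poly_Mapping.single i 1) f"
  shows "leads q (translate (unit_shift i) f - f)"
proof -
  let ?g = "translate (unit_shift i) f - f" and ?m = "q + Poly_Mapping.single i 1"
  let ?p = "rank (Poly_Mapping.single i 1)"
  have split: "s + Poly_Mapping.single i j = (s + Poly_Mapping.single i 1) + Poly_Mapping.single i (j - 1)"
    if "j \<ge> 1" for s and j :: nat
    using that by (simp add: add.assoc flip: single_add)
  have "rank s \<le> rank q" if s: "s \<in> Poly_Mapping.keys ?g" for s
  proof -
    have "Poly_Mapping.lookup ?g s \<noteq> 0"
      using s by (simp add: in_keys_iff)
    then obtain m where m: "m \<in> Poly_Mapping.keys f"
      "(\<Sum>j=1..Poly_Mapping.lookup m i.
         (of_nat (Poly_Mapping.lookup m i choose j) :: complex) when m = s + Poly_Mapping.single i j) \<noteq> 0"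
      unfolding lookup_unit_difference by (metis (no_types, lifting) mult_zero_right sum.neutral)
    from m(2) obtain j where j: "j \<ge> 1" "m = s + Poly_Mapping.single i j"
      by (smt (verit) atLeastAtMost_iff sum.neutral when_simps(2))
    have "rank s * ?p \<le> rank m"
      using rank_le_add[of "s + Poly_Mapping.single i 1"] j split[OF j(1)] by (simp add: rank_add)
    also have "\<dots> \<le> rank q * ?p"
      using lead m(1) by (simp add: leads_def rank_add)
    finally show ?thesis
      using rank_pos[of "Poly_Mapping.single i 1"] by simp
  qed
  moreover have "Poly_Mapping.lookup ?g q \<noteq> 0"
  proof -
    let ?c = "\<lambda>m. \<Sum>j=1..Poly_Mapping.lookup m i.
      (of_nat (Poly_Mapping.lookup m i choose j) :: complex) when m = q + Poly_Mapping.single i j"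
    \<comment> \<open>A monomial \<open>q + j e\<^sub>i\<close> with \<open>j > 1\<close> lies above the leading one, so it is absent from \<open>f\<close>.\<close>
    have only: "?c m = 0" if m: "m \<in> Poly_Mapping.keys f" "m \<noteq> ?m" for m
    proof (rule sum.neutral, rule ballI)
      fix j assume j: "j \<in> {1..Poly_Mapping.lookup m i}"
      have "m \<noteq> q + Poly_Mapping.single i j"
      proof
        assume eq: "m = q + Poly_Mapping.single i j"
        have "rank ?m \<le> rank m"
          using rank_le_add[of ?m] split[of j q] j eq by simp
        moreover have "rank m \<le> rank ?m"
          using lead m(1) by (simp add: leads_def)
        ultimately show False
          using m(2) inj_rank by (simp add: inj_def)
      qed
      then show "((of_nat (Poly_Mapping.lookup m i choose j) :: complex) when
          m = q + Poly_Mapping.single i j) = 0" by simp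
    qed
    have "?c ?m = (\<Sum>j=1..Poly_Mapping.lookup ?m i.
        if j = 1 then of_nat (Poly_Mapping.lookup ?m i) else 0)"
    proof (rule sum.cong)
      fix j :: nat
      have "Poly_Mapping.single i 1 = Poly_Mapping.single i j \<longleftrightarrow> j = 1"
        by (metis lookup_single_eq)
      then show "((of_nat (Poly_Mapping.lookup ?m i choose j) :: complex) when
          ?m = q + Poly_Mapping.single i j) = (if j = 1 then of_nat (Poly_Mapping.lookup ?m i) else 0)"
        by (simp add: when_def)
    qed simp
    also have "\<dots> = of_nat (Poly_Mapping.lookup ?m i)"
      by (simp add: lookup_add)
    finally have c: "?c ?m \<noteq> 0"
      by (simp add: lookup_add del: of_nat_Suc)
    have mem: "?m \<in> Poly_Mapping.keys f"
      using lead by (simp add: leads_def)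
    have "Poly_Mapping.lookup ?g q = Poly_Mapping.lookup f ?m * ?c ?m"
      unfolding lookup_unit_difference
      by (subst sum.remove[OF finite_keys mem], subst sum.neutral)
        (use only in \<open>simp_all del: One_nat_def\<close>)
    with c mem show ?thesis
      by (simp add: in_keys_iff)
  qed
  ultimately show ?thesis
    by (simp add: leads_def in_keys_iff)
qed

lemma lead_exps_down_closed:
  assumes M: "submodule M" and "m \<in> lead_exps M"
    and le: "\<And>k. Poly_Mapping.lookup q k \<le> Poly_Mapping.lookup m k"
  shows "q \<in> lead_exps M"
proof -
  have step: "q \<in> lead_exps M" if "q + Poly_Mapping.single i 1 \<in> lead_exps M" for q i
  proof -
    from that obtain f where f: "f \<in> M" "leads (q + Poly_Mapping.single i 1) f"
      by (auto simp: lead_exps_def)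
    have "translate (unit_shift i) f - f \<in> M"
      using M f(1) by (simp add: submodule_def cpoly.subspace_diff)
    with leads_unit_difference[OF f(2)] show ?thesis
      by (auto simp: lead_exps_def)
  qed
  have single: "q \<in> lead_exps M" if "q + Poly_Mapping.single i r \<in> lead_exps M" for q i r
    using that
  proof (induction r arbitrary: q)
    case (Suc r)
    have "q + Poly_Mapping.single i (Suc r) = q + Poly_Mapping.single i r + Poly_Mapping.single i 1"
      by (simp add: add.assoc flip: single_add)
    with Suc show ?case by (metis step)
  qed simp
  have sums: "q \<in> lead_exps M"
    if "finite S" "q + (\<Sum>k\<in>S. Poly_Mapping.single k (d k)) \<in> lead_exps M" for S q d
    using that
  proof (induction S arbitrary: q)
    case (insert k S)
    then have "q + Poly_Mapping.single k (d k) \<in> lead_exps M"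
      by (simp add: add.assoc)
    then show ?case by (rule single)
  qed simp
  have "m = q + (m - q)"
    by (rule poly_mapping_eqI) (simp add: lookup_add lookup_minus le)
  then show ?thesis
    using sums[of UNIV q "Poly_Mapping.lookup (m - q)"] assms(2)
    by (simp add: sum_single_lookup)
qed

text \<open>
  An element of the larger submodule outside the smaller one, chosen with least possible leading
  exponent, could be lowered further by subtracting a multiple of an element of the smaller one.
\<close>

lemma lead_exps_determine:
  assumes A: "cpoly.subspace A" and B: "cpoly.subspace B" and "A \<subseteq> B"
    and eq: "lead_exps B \<subseteq> lead_exps A"
  shows "A = B"
proof -
  have "f \<in> A" if "f \<in> B" "leads m f" for f m
    using that
  proof (induction "rank m" arbitrary: f m rule: less_induct)
    case less
    from less.prems eq obtain g where g: "g \<in> A" "leads m g"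
      by (auto simp: lead_exps_def)
    define c where "c = Poly_Mapping.lookup f m / Poly_Mapping.lookup g m"
    define h where "h = f - scale c g"
    have cg: "scale c g \<in> A"
      using A g(1) by (rule cpoly.subspace_scale)
    have "h \<in> B"
      unfolding h_def using B less.prems(1) cg \<open>A \<subseteq> B\<close> by (auto intro: cpoly.subspace_diff)
    have "h \<in> A"
    proof (cases "h = 0")
      case True
      then show ?thesis using A by (simp add: cpoly.subspace_0)
    next
      case False
      then obtain m' where m': "leads m' h" by (rule ex_leads)
      have hm: "Poly_Mapping.lookup h m = 0"
        using g(2) by (simp add: h_def c_def lookup_minus lookup_scale leads_def in_keys_iff)
      have nz: "Poly_Mapping.lookup h m' \<noteq> 0"
        using m' by (simp add: leads_def in_keys_iff)
      then have "m' \<in> Poly_Mapping.keys f \<or> m' \<in> Poly_Mapping.keys g"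
        by (auto simp: h_def lookup_minus lookup_scale in_keys_iff)
      then have "rank m' \<le> rank m"
        using less.prems(2) g(2) by (auto simp: leads_def)
      moreover have "rank m' \<noteq> rank m"
        using hm nz inj_rank by (auto simp: inj_eq)
      ultimately show ?thesis
        using less.hyps[OF _ \<open>h \<in> B\<close> m'] by simp
    qed
    then have "h + scale c g \<in> A"
      using A cg by (simp add: cpoly.subspace_add)
    then show ?case by (simp add: h_def)
  qed
  then have "B \<subseteq> A"
    using A by (metis cpoly.subspace_0 ex_leads subsetI)
  with \<open>A \<subseteq> B\<close> show ?thesis by blast
qed

lemma lead_exps_mono: "A \<subseteq> B \<Longrightarrow> lead_exps A \<subseteq> lead_exps B"
  by (auto simp: lead_exps_def)

end

section \<open>Descending chain condition and decomposition\<close>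

lemma wf_submodule_strict_subset:
  "wf {(A, B). submodule A \<and> submodule B \<and> A \<subset> (B :: ('n::finite) cpoly set)}"
  unfolding wf_iff_no_infinite_down_chain
proof
  assume "\<exists>F. \<forall>k. (F (Suc k), F k) \<in> {(A, B). submodule A \<and> submodule B \<and> A \<subset> (B :: 'n cpoly set)}"
  then obtain F :: "nat \<Rightarrow> 'n cpoly set"
    where sub: "\<And>k. submodule (F k)" and less: "\<And>k. F (Suc k) \<subset> F k" by blast
  obtain rank :: "('n \<Rightarrow>\<^sub>0 nat) \<Rightarrow> nat" where "monomial_rank rank"
    using ex_monomial_rank by blast
  then interpret monomial_rank rank .
  have "\<exists>u. u \<in> lead_exps (F k) - lead_exps (F (Suc k))" for k
  proof -
    have "\<not> lead_exps (F k) \<subseteq> lead_exps (F (Suc k))"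
      using lead_exps_determine[of "F (Suc k)" "F k"] sub less[of k]
      unfolding submodule_def by blast
    then show ?thesis by blast
  qed
  then obtain u where u: "\<And>k. u k \<in> lead_exps (F k) - lead_exps (F (Suc k))" by metis
  obtain i j where ij: "i < j" "\<And>k. Poly_Mapping.lookup (u i) k \<le> Poly_Mapping.lookup (u j) k"
    using dickson[of u] by blast
  have "decseq F"
    using less by (auto simp: decseq_Suc_iff)
  with ij(1) have "F j \<subseteq> F (Suc i)"
    by (simp add: decseqD)
  then have "u j \<in> lead_exps (F (Suc i))"
    using u[of j] lead_exps_mono by blast
  then have "u i \<in> lead_exps (F (Suc i))"
    using lead_exps_down_closed[OF sub] ij(2) by blast
  then show False using u[of i] by blast
qed

definition sum_of_indecomposables :: "('n::finite) cpoly set \<Rightarrow> bool" where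
  "sum_of_indecomposables M \<longleftrightarrow>
     (\<exists>k\<ge>1. \<exists>A :: nat \<Rightarrow> 'n cpoly set. (\<forall>i<k. indecomposable (A i)) \<and> M = (\<Sum>i<k. A i))"

lemma sum_of_indecomposables_add:
  fixes M N :: "('n::finite) cpoly set"
  assumes "sum_of_indecomposables M" "sum_of_indecomposables N"
  shows "sum_of_indecomposables (M + N)"
proof -
  obtain k and A :: "nat \<Rightarrow> 'n cpoly set" where A: "k \<ge> 1" "\<forall>i<k. indecomposable (A i)" "M = (\<Sum>i<k. A i)"
    using assms(1) unfolding sum_of_indecomposables_def by blast
  obtain l and B :: "nat \<Rightarrow> 'n cpoly set" where B: "l \<ge> 1" "\<forall>i<l. indecomposable (B i)" "N = (\<Sum>i<l. B i)"
    using assms(2) unfolding sum_of_indecomposables_def by blast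
  define C where "C i = (if i < k then A i else B (i - k))" for i
  have "(\<Sum>i<k + r. C i) = (\<Sum>i<k. A i) + (\<Sum>i<r. B i)" for r
    by (induction r) (simp_all add: C_def add.assoc)
  moreover have "\<forall>i<k + l. indecomposable (C i)"
    using A(2) B(2) by (simp add: C_def)
  ultimately show ?thesis
    unfolding sum_of_indecomposables_def A(3) B(3)
    using A(1) by (intro exI[of _ "k + l"] conjI exI[of _ C]) auto
qed

lemma sum_of_indecomposables_sum:
  fixes k :: nat
  assumes "k \<ge> 1" "\<forall>i<k. sum_of_indecomposables (A i)"
  shows "sum_of_indecomposables (\<Sum>i<k. A i)"
  using assms
proof (induction k rule: nat_induct_at_least)
  case base
  then show ?case by simp
next
  case (Suc k)
  then show ?case by (simp add: sum_of_indecomposables_add)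
qed

theorem proposition17:
  fixes M :: "('n::finite) cpoly set"
  assumes "submodule M"
  shows "\<exists>k\<ge>1. \<exists>A :: nat \<Rightarrow> 'n cpoly set.
           (\<forall>i<k. indecomposable (A i)) \<and> M = (\<Sum>i<k. A i)"
proof -
  have "sum_of_indecomposables M"
    using assms
  proof (induction M rule: wf_induct_rule[OF wf_submodule_strict_subset])
    case (1 M)
    show ?case
    proof (cases "decomposable M")
      case True
      then obtain k and A :: "nat \<Rightarrow> 'n cpoly set" where
        A: "k \<ge> 1" "\<forall>i<k. submodule (A i) \<and> A i \<subset> M" "M = (\<Sum>i<k. A i)"
        by (auto simp: decomposable_def)
      have "\<forall>i<k. sum_of_indecomposables (A i)"
        using 1 A(2) by blast
      then show ?thesis
        using sum_of_indecomposables_sum[of k A] A(1,3) by simp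
    next
      case False
      with 1 have "indecomposable M"
        by (simp add: indecomposable_def)
      then show ?thesis
        unfolding sum_of_indecomposables_def
        by (intro exI[of _ 1] conjI exI[of _ "\<lambda>_. M"]) auto
    qed
  qed
  then show ?thesis
    by (simp add: sum_of_indecomposables_def)
qed

end
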